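(* Let $a,b,k\geq 1$ be integers. If $Q_a$ and $Q_b$ each contain $k$ pairwise edge-disjoint symmetric chain decompositions (SCDs), then $Q_{a+b}$ contains $k$ pairwise edge-disjoint SCDs.
   Context: The $n$-cube $Q_n$ is the graph whose vertices are all bitstrings of length $n$, with an edge between any two bitstrings that differ in exactly one bit. The $k$th level of $Q_n$ is the set of all bitstrings of length $n$ with exactly $k$ many 1-bits. A symmetric chain in $Q_n$ is a path $(x_k,x_{k+1},\ldots,x_{n-k})$ in $Q_n$ (for some $0\leq k\leq n/2$) where $x_i$ is from level $i$ for all $k\leq i\leq n-k$ (a single vertex is allowed when $k=n-k$). A symmetric chain decomposition (SCD) of $Q_n$ is a partition of the vertices of $Q_n$ into symmetric chains. Two SCDs are edge-disjoint if the corresponding sets of paths are edge-disjoint, i.e., there are no two vertices that are consecutive in a chain of the first SCD and also consecutive in a chain of the second SCD. *)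

theory Defs
  imports Main "HOL-Library.Disjoint_Sets"
begin

definition cube_verts :: "nat \<Rightarrow> bool list set" where
  "cube_verts n = {x. length x = n}"

definition cube_adj :: "nat \<Rightarrow> bool list \<Rightarrow> bool list \<Rightarrow> bool" where
  "cube_adj n x y \<longleftrightarrow>
     x \<in> cube_verts n \<and> y \<in> cube_verts n \<and> (\<exists>!i. i < n \<and> x ! i \<noteq> y ! i)"

definition cube_level :: "nat \<Rightarrow> nat \<Rightarrow> bool list set" where
  "cube_level n k = {x \<in> cube_verts n. card {i. i < n \<and> x ! i} = k}"

text \<open>A chain is the list of its vertices in ascending order, so the entry at position \<open>j\<close> of a
  chain starting at level \<open>k\<close> is the vertex on level \<open>k + j\<close>.  Distinctness of the vertices is
  automatic, because they lie on different levels.\<close>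

definition symmetric_chain :: "nat \<Rightarrow> bool list list \<Rightarrow> bool" where
  "symmetric_chain n c \<longleftrightarrow>
     (\<exists>k. 2 * k \<le> n \<and> length c = n - 2 * k + 1 \<and>
          (\<forall>j < length c. c ! j \<in> cube_level n (k + j)) \<and>
          (\<forall>j. Suc j < length c \<longrightarrow> cube_adj n (c ! j) (c ! Suc j)))"

definition is_SCD :: "nat \<Rightarrow> bool list list set \<Rightarrow> bool" where
  "is_SCD n D \<longleftrightarrow>
     (\<forall>c \<in> D. symmetric_chain n c) \<and> (\<Union>c\<in>D. set c) = cube_verts n \<and> disjoint_family_on set D"

definition chain_edges :: "bool list list \<Rightarrow> bool list set set" where
  "chain_edges c = {{c ! j, c ! Suc j} | j. Suc j < length c}"

definition SCD_edge_disjoint :: "bool list list set \<Rightarrow> bool list list set \<Rightarrow> bool" where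
  "SCD_edge_disjoint D D' \<longleftrightarrow> (\<Union>c\<in>D. chain_edges c) \<inter> (\<Union>c\<in>D'. chain_edges c) = {}"

definition has_edge_disjoint_SCDs :: "nat \<Rightarrow> nat \<Rightarrow> bool" where
  "has_edge_disjoint_SCDs n k \<longleftrightarrow>
     (\<exists>F. finite F \<and> card F = k \<and> (\<forall>D \<in> F. is_SCD n D) \<and> pairwise SCD_edge_disjoint F)"

end

theory Submission imports Defs begin

text \<open>
  The vertices of \<open>Q\<^sub>a\<^sub>+\<^sub>b\<close> are the concatenations \<open>x @ y\<close> of a vertex of \<open>Q\<^sub>a\<close> and one of \<open>Q\<^sub>b\<close>.
  Given SCDs \<open>A\<close> of \<open>Q\<^sub>a\<close> and \<open>B\<close> of \<open>Q\<^sub>b\<close>, the products of a chain in \<open>A\<close> with a chain in \<open>B\<close>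
  partition the vertices of \<open>Q\<^sub>a\<^sub>+\<^sub>b\<close> into grids, and each grid splits into nested L-shaped
  symmetric chains (the \<open>hook\<close>s below); together they form an SCD of \<open>Q\<^sub>a\<^sub>+\<^sub>b\<close> (\<open>is_SCD_prod\<close>).

  Every edge of a hook moves in one of the two factors only, and there it moves along an edge of
  \<open>A\<close> or of \<open>B\<close> (\<open>hook_edge_cases\<close>).  An edge shared by two such products would therefore project
  to an edge shared by the two SCDs of \<open>Q\<^sub>a\<close> or by the two SCDs of \<open>Q\<^sub>b\<close>.  Hence pairing up the
  given families in any order and taking products yields pairwise edge-disjoint SCDs.  These are
  still \<open>k\<close> distinct ones, because an SCD of a cube of positive dimension has an edge and so is
  not edge-disjoint from itself.
\<close>

section \<open>Levels and edges of a product of cubes\<close>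

lemma cube_level_iff: "x \<in> cube_level n k \<longleftrightarrow> length x = n \<and> length (filter id x) = k"
  by (auto simp: cube_level_def cube_verts_def length_filter_conv_card)

lemma cube_level_append:
  "x \<in> cube_level a p \<Longrightarrow> y \<in> cube_level b q \<Longrightarrow> x @ y \<in> cube_level (a + b) (p + q)"
  by (auto simp: cube_level_iff)

lemma cube_adj_append_right:
  assumes "cube_adj a x x'" "length y = b"
  shows "cube_adj (a + b) (x @ y) (x' @ y)"
proof -
  have len: "length x = a" "length x' = a"
    and ex1: "\<exists>!i. i < a \<and> x ! i \<noteq> x' ! i"
    using assms(1) by (simp_all add: cube_adj_def cube_verts_def)
  obtain i where i: "i < a" "x ! i \<noteq> x' ! i" "\<And>j. j < a \<Longrightarrow> x ! j \<noteq> x' ! j \<Longrightarrow> j = i"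
    using ex1 by blast
  have "\<exists>!i. i < a + b \<and> (x @ y) ! i \<noteq> (x' @ y) ! i"
  proof (intro ex1I[of _ i])
    fix j assume j: "j < a + b \<and> (x @ y) ! j \<noteq> (x' @ y) ! j"
    then have "j < a" "x ! j \<noteq> x' ! j"
      using len by (auto simp: nth_append split: if_splits)
    then show "j = i" by (rule i(3))
  qed (use i(1,2) len in \<open>simp add: nth_append\<close>)
  then show ?thesis
    using len assms(2) by (simp add: cube_adj_def cube_verts_def)
qed

lemma cube_adj_append_left:
  assumes "cube_adj b y y'" "length x = a"
  shows "cube_adj (a + b) (x @ y) (x @ y')"
proof -
  have len: "length y = b" "length y' = b"
    and ex1: "\<exists>!i. i < b \<and> y ! i \<noteq> y' ! i"
    using assms(1) by (simp_all add: cube_adj_def cube_verts_def)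
  obtain i where i: "i < b" "y ! i \<noteq> y' ! i" "\<And>j. j < b \<Longrightarrow> y ! j \<noteq> y' ! j \<Longrightarrow> j = i"
    using ex1 by blast
  have "\<exists>!i. i < a + b \<and> (x @ y) ! i \<noteq> (x @ y') ! i"
  proof (intro ex1I[of _ "a + i"])
    fix j assume j: "j < a + b \<and> (x @ y) ! j \<noteq> (x @ y') ! j"
    then have "a \<le> j" "y ! (j - a) \<noteq> y' ! (j - a)" "j - a < b"
      using assms(2) by (auto simp: nth_append split: if_splits)
    then show "j = a + i" using i(3)[of "j - a"] by simp
  qed (use i(1,2) assms(2) in \<open>simp add: nth_append\<close>)
  then show ?thesis
    using len assms(2) by (simp add: cube_adj_def cube_verts_def)
qed

section \<open>Symmetric chains\<close>

lemma symmetric_chain_nonempty: "symmetric_chain n c \<Longrightarrow> 0 < length c"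
  by (auto simp: symmetric_chain_def)

lemma symmetric_chain_vertex_length: "symmetric_chain n c \<Longrightarrow> i < length c \<Longrightarrow> length (c ! i) = n"
  by (auto simp: symmetric_chain_def cube_level_iff)

lemma symmetric_chain_adj:
  "symmetric_chain n c \<Longrightarrow> Suc i < length c \<Longrightarrow> cube_adj n (c ! i) (c ! Suc i)"
  by (auto simp: symmetric_chain_def)

lemma symmetric_chain_nth_inj:
  assumes "symmetric_chain n c" "i < length c" "j < length c" "c ! i = c ! j"
  shows "i = j"
proof -
  obtain k where "\<forall>j < length c. c ! j \<in> cube_level n (k + j)"
    using assms(1) by (auto simp: symmetric_chain_def)
  then have "c ! i \<in> cube_level n (k + i)" "c ! j \<in> cube_level n (k + j)"
    using assms by auto
  then show ?thesis using assms(4) by (auto simp: cube_level_iff)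
qed

lemma card_chain_edge:
  assumes "symmetric_chain n c" "e \<in> chain_edges c"
  shows "card e = 2"
proof -
  obtain i where i: "e = {c ! i, c ! Suc i}" "Suc i < length c"
    using assms(2) by (auto simp: chain_edges_def)
  have "c ! i \<noteq> c ! Suc i"
    using symmetric_chain_nth_inj[OF assms(1), of i "Suc i"] i(2) by auto
  then show ?thesis using i(1) by simp
qed

section \<open>Splitting a product of two chains into hooks\<close>

text \<open>
  Let \<open>c\<close> and \<open>d\<close> have \<open>m + 1\<close> and \<open>l + 1\<close> vertices.  In the grid \<open>{0..m} \<times> {0..l}\<close> of positions, the \<open>j\<close>-th hook runs along row \<open>j\<close> from \<open>(0, j)\<close> to
  \<open>(m - j, j)\<close> and then up the column to \<open>(m - j, l)\<close>.  Writing both coordinates with \<open>min\<close> and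
  truncated subtraction covers the two legs by one formula; their sum at time \<open>t\<close> is always
  \<open>t + j\<close>.  The hook thus starts at rank \<open>j\<close> and ends at rank \<open>m + l - j\<close>, which makes it
  symmetric.
\<close>

definition hook :: "bool list list \<Rightarrow> bool list list \<Rightarrow> nat \<Rightarrow> bool list list" where
  "hook c d j = map (\<lambda>t. c ! min t (length c - 1 - j) @ d ! (j + (t - (length c - 1 - j))))
     [0..<length c + length d - 1 - 2 * j]"

definition hooks :: "bool list list \<Rightarrow> bool list list \<Rightarrow> bool list list set" where
  "hooks c d = hook c d ` {j. j < length c \<and> j < length d}"

lemma length_hook: "length (hook c d j) = length c + length d - 1 - 2 * j"
  by (simp add: hook_def)

lemma hook_nth:
  "t < length c + length d - 1 - 2 * j \<Longrightarrow>
   hook c d j ! t = c ! min t (length c - 1 - j) @ d ! (j + (t - (length c - 1 - j)))"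
  by (simp add: hook_def)

lemma hook_step_cases:
  assumes "j < length c" "j < length d" "Suc t < length (hook c d j)"
  obtains (first) "Suc t < length c"
      "hook c d j ! t = c ! t @ d ! j" "hook c d j ! Suc t = c ! Suc t @ d ! j"
  | (second) x y where "x < length c" "Suc y < length d"
      "hook c d j ! t = c ! x @ d ! y" "hook c d j ! Suc t = c ! x @ d ! Suc y"
proof (cases "t < length c - 1 - j")
  case True
  then show ?thesis
    using assms by (intro first) (auto simp: length_hook hook_nth min_def)
next
  case False
  have t: "Suc t < length c + length d - 1 - 2 * j"
    using assms(3) by (simp add: length_hook)
  have "min t (length c - 1 - j) = length c - 1 - j"
    "min (Suc t) (length c - 1 - j) = length c - 1 - j"
    "j + (Suc t - (length c - 1 - j)) = Suc (j + (t - (length c - 1 - j)))"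
    using False by auto
  then have "hook c d j ! t = c ! (length c - 1 - j) @ d ! (j + (t - (length c - 1 - j)))"
    "hook c d j ! Suc t = c ! (length c - 1 - j) @ d ! Suc (j + (t - (length c - 1 - j)))"
    using t by (simp_all only: hook_nth Suc_lessD)
  then show ?thesis
    using assms(1,2) False t by (intro second) auto
qed

lemma symmetric_chain_hook:
  assumes c: "symmetric_chain a c" and d: "symmetric_chain b d"
    and j: "j < length c" "j < length d"
  shows "symmetric_chain (a + b) (hook c d j)"
proof -
  obtain p where p: "2 * p \<le> a" "length c = a - 2 * p + 1"
    "\<And>i. i < length c \<Longrightarrow> c ! i \<in> cube_level a (p + i)"
    using c by (auto simp: symmetric_chain_def)
  obtain q where q: "2 * q \<le> b" "length d = b - 2 * q + 1"
    "\<And>i. i < length d \<Longrightarrow> d ! i \<in> cube_level b (q + i)"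
    using d by (auto simp: symmetric_chain_def)
  have lev: "hook c d j ! t \<in> cube_level (a + b) (p + q + j + t)" if "t < length (hook c d j)" for t
  proof -
    let ?x = "min t (length c - 1 - j)" and ?y = "j + (t - (length c - 1 - j))"
    have t: "t < length c + length d - 1 - 2 * j" using that by (simp add: length_hook)
    have "?x < length c" "?y < length d" using t j by auto
    then have "c ! ?x @ d ! ?y \<in> cube_level (a + b) ((p + ?x) + (q + ?y))"
      by (intro cube_level_append p q)
    moreover have "(p + ?x) + (q + ?y) = p + q + j + t" by auto
    ultimately show ?thesis using hook_nth[OF t] by metis
  qed
  have adj: "cube_adj (a + b) (hook c d j ! t) (hook c d j ! Suc t)"
    if "Suc t < length (hook c d j)" for t
    using j that
  proof (cases rule: hook_step_cases)
    case first
    then show ?thesis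
      using cube_adj_append_right[OF symmetric_chain_adj[OF c]]
        symmetric_chain_vertex_length[OF d] j by simp
  next
    case (second x y)
    then show ?thesis
      using cube_adj_append_left[OF symmetric_chain_adj[OF d]]
        symmetric_chain_vertex_length[OF c] by simp
  qed
  have "2 * (p + q + j) \<le> a + b" "length (hook c d j) = a + b - 2 * (p + q + j) + 1"
    using p q j by (auto simp: length_hook)
  with lev adj show ?thesis unfolding symmetric_chain_def by blast
qed

text \<open>
  The projections \<open>take a\<close> and \<open>drop a\<close> send an edge either to an edge or, when the move happens
  in the other factor, to a single vertex.
\<close>

lemma hook_edge_cases:
  assumes c: "symmetric_chain a c" and d: "symmetric_chain b d"
    and j: "j < length c" "j < length d" and e: "e \<in> chain_edges (hook c d j)"
  shows "take a ` e \<in> chain_edges c \<and> card (drop a ` e) = 1 \<or>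
         card (take a ` e) = 1 \<and> drop a ` e \<in> chain_edges d"
proof -
  obtain t where t: "Suc t < length (hook c d j)" "e = {hook c d j ! t, hook c d j ! Suc t}"
    using e by (auto simp: chain_edges_def)
  note len = symmetric_chain_vertex_length[OF c]
  from j t(1) show ?thesis
  proof (cases rule: hook_step_cases)
    case first
    then have "take a ` e = {c ! t, c ! Suc t}" "drop a ` e = {d ! j}"
      using t(2) len by auto
    with first show ?thesis by (auto simp: chain_edges_def)
  next
    case (second x y)
    then have "take a ` e = {c ! x}" "drop a ` e = {d ! y, d ! Suc y}"
      using t(2) len by auto
    with second show ?thesis by (auto simp: chain_edges_def)
  qed
qed

text \<open>
  A grid point on or below the antidiagonal \<open>x + y = m\<close> lies on the horizontal leg of hook \<open>y\<close>,
  and one above it on the vertical leg of hook \<open>m - x\<close>.  As this rule depends on the point alone,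
  the hooks cover the grid without overlap.
\<close>

definition hook_index :: "bool list list \<Rightarrow> nat \<Rightarrow> nat \<Rightarrow> nat" where
  "hook_index c x y = (if x + y < length c then y else length c - 1 - x)"

lemma hook_covers:
  assumes "x < length c" "y < length d"
  shows "\<exists>h \<in> hooks c d. c ! x @ d ! y \<in> set h"
proof -
  let ?j = "hook_index c x y"
  let ?t = "x + y - ?j"
  have j: "?j < length c" "?j < length d" and t: "?t < length c + length d - 1 - 2 * ?j"
    using assms by (auto simp: hook_index_def)
  have "min ?t (length c - 1 - ?j) = x" "?j + (?t - (length c - 1 - ?j)) = y"
    using assms by (auto simp: hook_index_def)
  with hook_nth[OF t] have "hook c d ?j ! ?t = c ! x @ d ! y" by simp
  with t have "c ! x @ d ! y \<in> set (hook c d ?j)"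
    by (metis length_hook nth_mem)
  with j show ?thesis by (auto simp: hooks_def)
qed

lemma hook_vertexE:
  assumes "v \<in> set (hook c d j)" "j < length c" "j < length d"
  obtains x y where "x < length c" "y < length d" "v = c ! x @ d ! y" "j = hook_index c x y"
proof -
  obtain t where t: "t < length c + length d - 1 - 2 * j" "v = hook c d j ! t"
    using assms(1) by (auto simp: in_set_conv_nth length_hook)
  show ?thesis
  proof (rule that)
    show "v = c ! min t (length c - 1 - j) @ d ! (j + (t - (length c - 1 - j)))"
      using t by (simp add: hook_nth)
    show "j = hook_index c (min t (length c - 1 - j)) (j + (t - (length c - 1 - j)))"
      using assms(2,3) by (auto simp: hook_index_def min_def)
  qed (use t assms in auto)
qed

section \<open>The product of two symmetric chain decompositions\<close>

definition SCD_prod :: "bool list list set \<Rightarrow> bool list list set \<Rightarrow> bool list list set" where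
  "SCD_prod A B = (\<Union>c\<in>A. \<Union>d\<in>B. hooks c d)"

lemma SCD_chain: "is_SCD n D \<Longrightarrow> c \<in> D \<Longrightarrow> symmetric_chain n c"
  by (simp add: is_SCD_def)

lemma SCD_chain_through:
  assumes "is_SCD n D" "length v = n"
  obtains c i where "c \<in> D" "i < length c" "v = c ! i"
proof -
  have "v \<in> (\<Union>c\<in>D. set c)"
    using assms by (simp add: is_SCD_def cube_verts_def)
  then show ?thesis using that by (auto simp: in_set_conv_nth)
qed

lemma SCD_chain_unique:
  assumes "is_SCD n D" "c \<in> D" "c' \<in> D" "i < length c" "i' < length c'" "c ! i = c' ! i'"
  shows "c = c'" "i = i'"
proof -
  have "c ! i \<in> set c \<inter> set c'"
    using assms nth_mem by (metis IntI)
  then show "c = c'"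
    using assms(1-3) unfolding is_SCD_def disjoint_family_on_def by blast
  then show "i = i'"
    using symmetric_chain_nth_inj[OF SCD_chain[OF assms(1,2)]] assms(4-6) by simp
qed

lemma SCD_prodE:
  assumes "h \<in> SCD_prod A B"
  obtains c d j where "c \<in> A" "d \<in> B" "j < length c" "j < length d" "h = hook c d j"
  using assms by (auto simp: SCD_prod_def hooks_def)

lemma is_SCD_prod:
  assumes A: "is_SCD a A" and B: "is_SCD b B"
  shows "is_SCD (a + b) (SCD_prod A B)"
proof -
  have chains: "symmetric_chain (a + b) h" if "h \<in> SCD_prod A B" for h
    using that by (elim SCD_prodE) (simp add: symmetric_chain_hook SCD_chain[OF A] SCD_chain[OF B])
  have "(\<Union>h\<in>SCD_prod A B. set h) = cube_verts (a + b)"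
  proof
    show "(\<Union>h\<in>SCD_prod A B. set h) \<subseteq> cube_verts (a + b)"
      using symmetric_chain_vertex_length[OF chains]
      by (auto simp: in_set_conv_nth cube_verts_def)
    show "cube_verts (a + b) \<subseteq> (\<Union>h\<in>SCD_prod A B. set h)"
    proof
      fix v assume "v \<in> cube_verts (a + b)"
      then have len: "length (take a v) = a" "length (drop a v) = b"
        by (auto simp: cube_verts_def)
      obtain c x where c: "c \<in> A" "x < length c" "take a v = c ! x"
        using SCD_chain_through[OF A len(1)] .
      obtain d y where d: "d \<in> B" "y < length d" "drop a v = d ! y"
        using SCD_chain_through[OF B len(2)] .
      have "v = c ! x @ d ! y" using c(3) d(3) by (metis append_take_drop_id)
      then show "v \<in> (\<Union>h\<in>SCD_prod A B. set h)"
        using hook_covers[OF c(2) d(2)] c(1) d(1) by (auto simp: SCD_prod_def)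
    qed
  qed
  moreover have "disjoint_family_on set (SCD_prod A B)"
    unfolding disjoint_family_on_def
  proof (intro ballI impI, rule ccontr)
    fix h h' assume h: "h \<in> SCD_prod A B" and h': "h' \<in> SCD_prod A B" and ne: "h \<noteq> h'"
      and meet: "set h \<inter> set h' \<noteq> {}"
    obtain c d j where hd: "c \<in> A" "d \<in> B" "j < length c" "j < length d" "h = hook c d j"
      using SCD_prodE[OF h] .
    obtain c' d' j' where hd': "c' \<in> A" "d' \<in> B" "j' < length c'" "j' < length d'" "h' = hook c' d' j'"
      using SCD_prodE[OF h'] .
    obtain v where v: "v \<in> set (hook c d j)" "v \<in> set (hook c' d' j')"
      using meet hd(5) hd'(5) by auto
    obtain x y where xy: "x < length c" "y < length d" "v = c ! x @ d ! y" "j = hook_index c x y"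
      using hook_vertexE[OF v(1) hd(3,4)] .
    obtain x' y' where xy': "x' < length c'" "y' < length d'" "v = c' ! x' @ d' ! y'"
        "j' = hook_index c' x' y'"
      using hook_vertexE[OF v(2) hd'(3,4)] .
    have "length (c ! x) = a" "length (c' ! x') = a"
      using hd(1) hd'(1) xy(1) xy'(1) SCD_chain[OF A] symmetric_chain_vertex_length by blast+
    then have "c ! x = c' ! x'" "d ! y = d' ! y'"
      using xy(3) xy'(3) by auto
    then have "c = c'" "x = x'" "d = d'" "y = y'"
      using SCD_chain_unique[OF A hd(1) hd'(1) xy(1) xy'(1)]
        SCD_chain_unique[OF B hd(2) hd'(2) xy(2) xy'(2)] by auto
    then show False using ne hd(5) hd'(5) xy(4) xy'(4) by simp
  qed
  ultimately show ?thesis using chains by (simp add: is_SCD_def)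
qed

section \<open>Edge-disjointness\<close>

lemma SCD_prod_edge_cases:
  assumes "is_SCD a A" "is_SCD b B" "e \<in> (\<Union>h\<in>SCD_prod A B. chain_edges h)"
  shows "take a ` e \<in> (\<Union>c\<in>A. chain_edges c) \<and> card (drop a ` e) = 1 \<or>
         card (take a ` e) = 1 \<and> drop a ` e \<in> (\<Union>d\<in>B. chain_edges d)"
proof -
  obtain h where "h \<in> SCD_prod A B" "e \<in> chain_edges h" using assms(3) by auto
  then show ?thesis
    using hook_edge_cases[OF SCD_chain[OF assms(1)] SCD_chain[OF assms(2)]]
    by (elim SCD_prodE) blast
qed

lemma card_SCD_edge: "is_SCD n D \<Longrightarrow> e \<in> (\<Union>c\<in>D. chain_edges c) \<Longrightarrow> card e = 2"
  using card_chain_edge SCD_chain by blast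

text \<open>
  An edge common to both products cannot move in the first factor according to one product and in
  the second factor according to the other: its projection would have both one and two elements.
\<close>

lemma SCD_edge_disjoint_prod:
  assumes A: "is_SCD a A" "is_SCD a A'" and B: "is_SCD b B" "is_SCD b B'"
    and disj: "SCD_edge_disjoint A A'" "SCD_edge_disjoint B B'"
  shows "SCD_edge_disjoint (SCD_prod A B) (SCD_prod A' B')"
proof -
  have False if "e \<in> (\<Union>h\<in>SCD_prod A B. chain_edges h)" "e \<in> (\<Union>h\<in>SCD_prod A' B'. chain_edges h)"
    for e
  proof -
    have "\<not> (card (take a ` e) = 1 \<and> card (take a ` e) = 2)" by simp
    then show False
      using SCD_prod_edge_cases[OF A(1) B(1) that(1)] SCD_prod_edge_cases[OF A(2) B(2) that(2)]
        card_SCD_edge[OF A(1), of "take a ` e"] card_SCD_edge[OF A(2), of "take a ` e"]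
        disj[unfolded SCD_edge_disjoint_def disjoint_iff]
      by metis
  qed
  then show ?thesis unfolding SCD_edge_disjoint_def by blast
qed

text \<open>
  The chain through the all-zeros vertex starts at level 0, so it has \<open>n + 1\<close> vertices.
\<close>

lemma SCD_not_edge_disjoint_self:
  assumes D: "is_SCD n D" and n: "n \<ge> 1"
  shows "\<not> SCD_edge_disjoint D D"
proof -
  obtain c i where c: "c \<in> D" "i < length c" "replicate n False = c ! i"
    using SCD_chain_through[OF D, of "replicate n False"] by auto
  obtain k where k: "length c = n - 2 * k + 1" "\<forall>j < length c. c ! j \<in> cube_level n (k + j)"
    using SCD_chain[OF D c(1)] by (auto simp: symmetric_chain_def)
  have "replicate n False \<in> cube_level n (k + i)" using k c by auto
  then have "k = 0" by (simp add: cube_level_iff)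
  then have "{c ! 0, c ! Suc 0} \<in> chain_edges c"
    using k(1) n by (auto simp: chain_edges_def)
  then show ?thesis using c(1) by (auto simp: SCD_edge_disjoint_def)
qed

theorem theorem5:
  fixes a b k :: nat
  assumes "a \<ge> 1" and "b \<ge> 1" and "k \<ge> 1"
    and "has_edge_disjoint_SCDs a k" and "has_edge_disjoint_SCDs b k"
  shows "has_edge_disjoint_SCDs (a + b) k"
proof -
  obtain F where F: "finite F" "card F = k" "\<And>D. D \<in> F \<Longrightarrow> is_SCD a D" "pairwise SCD_edge_disjoint F"
    using assms(4) by (auto simp: has_edge_disjoint_SCDs_def)
  obtain G where G: "finite G" "card G = k" "\<And>D. D \<in> G \<Longrightarrow> is_SCD b D" "pairwise SCD_edge_disjoint G"
    using assms(5) by (auto simp: has_edge_disjoint_SCDs_def)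
  obtain f where f: "bij_betw f F G"
    using finite_same_card_bij[OF F(1) G(1)] F(2) G(2) by auto
  let ?P = "\<lambda>D. SCD_prod D (f D)"
  have fG: "f D \<in> G" if "D \<in> F" for D using f that by (rule bij_betwE[THEN bspec])
  have scd: "is_SCD (a + b) (?P D)" if "D \<in> F" for D
    using that by (intro is_SCD_prod F(3) G(3) fG)
  have disj: "SCD_edge_disjoint (?P D) (?P D')" if D: "D \<in> F" "D' \<in> F" "D \<noteq> D'" for D D'
  proof -
    have "f D \<noteq> f D'" using f D by (auto simp: bij_betw_def inj_on_def)
    then have "SCD_edge_disjoint (f D) (f D')"
      using G(4) fG D by (auto simp: pairwise_def)
    moreover have "SCD_edge_disjoint D D'"
      using F(4) D by (simp add: pairwise_def)
    ultimately show ?thesis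
      using SCD_edge_disjoint_prod F(3) G(3) fG D by blast
  qed
  have "inj_on ?P F"
  proof (rule inj_onI, rule ccontr)
    fix D D' assume D: "D \<in> F" "D' \<in> F" "?P D = ?P D'" "D \<noteq> D'"
    then have "SCD_edge_disjoint (?P D) (?P D)" using disj[of D D'] by simp
    moreover have "a + b \<ge> 1" using assms(1) by simp
    ultimately show False using SCD_not_edge_disjoint_self[OF scd[OF D(1)]] by blast
  qed
  then have "card (?P ` F) = k" using F(2) by (simp add: card_image)
  moreover have "pairwise SCD_edge_disjoint (?P ` F)"
    using disj by (auto simp: pairwise_def)
  ultimately show ?thesis
    unfolding has_edge_disjoint_SCDs_def using F(1) scd by (intro exI[of _ "?P ` F"]) auto
qed

end
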